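(* Let $z_1, z_2 \in \mathbb{R}_{>0}$ and let $(\Gamma_n)_{n\ge 1}$ be the sequence defined by $\Gamma_1 = z_1$, $\Gamma_2 = z_2$, and, for every integer $n \ge 3$, $$\Gamma_n = \Gamma_{\epsilon(n)}\cdot\prod_{k=1}^{\lceil n/2\rceil - 1} G(n-2k).$$ Then $(\Gamma_n)_{n\ge1}$ solves the recurrence $z_{n+2} = \frac{1}{z_{n+1}} + z_n$ with initial values $z_1, z_2$; that is, for every integer $n \ge 3$, $$\Gamma_n = \frac{1}{\Gamma_{n-1}} + \Gamma_{n-2}.$$
   Context: For an integer $n$, $\epsilon(n) = 2$ if $n$ is even and $\epsilon(n) = 1$ if $n$ is odd. For an integer $j \ge 1$, $G(j) = \dfrac{j + \Gamma_1\Gamma_2}{j - 1 + \Gamma_1\Gamma_2}$, where $\Gamma_1 = z_1$ and $\Gamma_2 = z_2$ are the given positive real numbers. *)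

theory Defs
  imports Complex_Main
begin

definition eps :: "int \<Rightarrow> nat" where
  "eps n = (if even n then 2 else 1)"

(* Only used for j >= 1; then the denominator is positive whenever \<Gamma> 1 and \<Gamma> 2 are. *)
definition G :: "(nat \<Rightarrow> real) \<Rightarrow> int \<Rightarrow> real" where
  "G \<Gamma> j = (of_int j + \<Gamma> 1 * \<Gamma> 2) / (of_int j - 1 + \<Gamma> 1 * \<Gamma> 2)"

end

(* Consecutive quotients of the product formula telescope to \<Gamma> (n+2) = \<Gamma> n * G n, and with
   c = \<Gamma> 1 * \<Gamma> 2 this gives the invariant \<Gamma> n * \<Gamma> (n+1) = n - 1 + c. Hence
   \<Gamma> (n+2) - \<Gamma> n = \<Gamma> n / (n - 1 + c) = 1 / \<Gamma> (n+1). *)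
theory Submission
  imports Defs
begin

text \<open>Serves to compare the products for \<open>n + 2\<close> and \<open>n\<close>: raising
  the index by one offsets the change of the argument by 2, so only the first factor is new.\<close>

lemma prod_int_atLeast1_shift:
  fixes f :: "int \<Rightarrow> 'a::comm_monoid_mult"
  assumes "0 \<le> m"
  shows "(\<Prod>k = 1..m + 1. f k) = f 1 * (\<Prod>k = 1..m. f (k + 1))"
proof -
  have "{1..m + 1} = insert 1 {2..m + 1}"
    using assms by auto
  moreover have "(\<Prod>k = 2..m + 1. f k) = (\<Prod>k = 1..m. f (k + 1))"
    by (rule prod.reindex_bij_witness[where i = "\<lambda>k. k + 1" and j = "\<lambda>k. k - 1"]) auto
  ultimately show ?thesis
    by simp
qed

text \<open>Both \<open>n\<close> and \<open>n + 2\<close> have the same parity, hence the same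
  leading term, and the product for \<open>n + 2\<close> has exactly one more factor, the one at
  \<open>k = 1\<close>, which is \<open>G \<Gamma> (int n)\<close>.\<close>

lemma prod_formula_step:
  assumes "\<forall>n\<ge>3. \<Gamma> n = \<Gamma> (eps (int n)) * (\<Prod>k = 1..\<lceil>real n / 2\<rceil> - 1. G \<Gamma> (int n - 2 * k))"
    and "n \<ge> 1"
  shows "\<Gamma> (n + 2) = \<Gamma> n * G \<Gamma> (int n)"
proof -
  define m where "m = \<lceil>real n / 2\<rceil> - 1"
  have m: "0 \<le> m"
    using \<open>n \<ge> 1\<close> unfolding m_def by simp
  have m': "\<lceil>real (n + 2) / 2\<rceil> - 1 = m + 1"
  proof -
    have "real (n + 2) / 2 = real n / 2 + 1"
      by simp
    then show ?thesis
      by (simp only: m_def ceiling_add_one)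
  qed
  have formula: "\<Gamma> n = \<Gamma> (eps (int n)) * (\<Prod>k = 1..m. G \<Gamma> (int n - 2 * k))"
  proof (cases "n \<ge> 3")
    case True
    then show ?thesis
      using assms(1) by (simp add: m_def)
  next
    \<comment> \<open>The hypothesis says nothing about \<open>n = 1\<close> and
      \<open>n = 2\<close>, but there \<open>m = 0\<close>, the product is empty and
      \<open>eps (int n)\<close> is \<open>n\<close> itself.\<close>
    case False
    then have "n = 1 \<or> n = 2"
      using \<open>n \<ge> 1\<close> by auto
    moreover have "\<lceil>1 / 2 :: real\<rceil> = 1"
      by (simp add: ceiling_eq_iff)
    ultimately show ?thesis
      by (auto simp: m_def eps_def)
  qed
  have "\<Gamma> (n + 2) = \<Gamma> (eps (int (n + 2))) * (\<Prod>k = 1..m + 1. G \<Gamma> (int (n + 2) - 2 * k))"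
    using assms(1)[rule_format, of "n + 2"] \<open>n \<ge> 1\<close> unfolding m' by simp
  also have "\<dots> = \<Gamma> (eps (int n)) * (\<Prod>k = 1..m. G \<Gamma> (int n - 2 * k)) * G \<Gamma> (int n)"
    by (simp add: prod_int_atLeast1_shift[OF m] eps_def)
  finally show ?thesis
    by (simp add: formula[symmetric])
qed

theorem proposition1p2:
  fixes z1 z2 :: real and \<Gamma> :: "nat \<Rightarrow> real"
  assumes "z1 > 0" and "z2 > 0"
    and "\<Gamma> 1 = z1" and "\<Gamma> 2 = z2"
    and "\<forall>n\<ge>3. \<Gamma> n = \<Gamma> (eps (int n)) * (\<Prod>k = 1..\<lceil>real n / 2\<rceil> - 1. G \<Gamma> (int n - 2 * k))"
  shows "\<forall>n\<ge>3. \<Gamma> n = 1 / \<Gamma> (n - 1) + \<Gamma> (n - 2)"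
proof -
  define c where "c = \<Gamma> 1 * \<Gamma> 2"
  have c: "c > 0"
    using assms(1-4) by (simp add: c_def)
  have step: "\<Gamma> (n + 2) = \<Gamma> n * ((real n + c) / (real n - 1 + c))" if "n \<ge> 1" for n
    using prod_formula_step[OF assms(5) that] by (simp add: G_def c_def)
  have pos: "real n - 1 + c > 0" if "n \<ge> 1" for n
    using c that by simp
  have invariant: "\<Gamma> n * \<Gamma> (n + 1) = real n - 1 + c" if "n \<ge> 1" for n
    using that
  proof (induction n rule: nat_induct_at_least)
    case base
    show ?case
      by (simp add: c_def numeral_2_eq_2)
  next
    case (Suc n)
    \<comment> \<open>By the induction hypothesis the product on the right equals the denominator,
      so only \<open>real n + c\<close> survives.\<close>
    have "\<Gamma> (Suc n) * \<Gamma> (Suc n + 1) = \<Gamma> n * \<Gamma> (n + 1) * ((real n + c) / (real n - 1 + c))"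
      using step[OF Suc.hyps] by simp
    then show ?case
      using Suc.IH pos[OF Suc.hyps] by simp
  qed
  have "\<Gamma> (n + 2) = 1 / \<Gamma> (n + 1) + \<Gamma> n" if "n \<ge> 1" for n
  proof -
    \<comment> \<open>A factor of a positive product cannot vanish, so positivity of the whole
      sequence need not be shown.\<close>
    have "\<Gamma> (n + 1) \<noteq> 0"
      using invariant[OF that] pos[OF that] by auto
    \<comment> \<open>The invariants at \<open>n\<close> and \<open>n + 1\<close> differ by 1;
      dividing by \<open>\<Gamma> (n + 1)\<close> gives the recurrence.\<close>
    moreover have "\<Gamma> (n + 1) * \<Gamma> (n + 2) = 1 + \<Gamma> n * \<Gamma> (n + 1)"
      using invariant[OF that] invariant[of "n + 1"] by simp
    ultimately show ?thesis
      by (simp add: field_simps)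
  qed
  note recurrence = this
  show ?thesis
  proof (intro allI impI)
    fix n :: nat
    assume "n \<ge> 3"
    then show "\<Gamma> n = 1 / \<Gamma> (n - 1) + \<Gamma> (n - 2)"
      using recurrence[of "n - 2"] by (simp add: numeral_eq_Suc Suc_diff_Suc)
  qed
qed

end
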